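(* Let $C$ be a conformal algebra and let $f(a_1,\dots,a_n)=\sum_{\sigma\in S_n} t_\sigma(a_{1\sigma},\dots,a_{n\sigma})$ be a homogeneous multilinear non-associative polynomial over $\Bbbk$. If the coefficient algebra $\operatorname{Coeff} C$ satisfies the identity $f=0$, then $C$, regarded as a pseudoalgebra, satisfies the pseudo-identity $f^*=0$, i.e. $$\sum_{\sigma\in S_n}(\sigma\otimes_H \mathrm{id}_C)\, t^*_\sigma(a_{1\sigma},\dots,a_{n\sigma})=0 \quad\text{in } H^{\otimes n}\otimes_H C$$ for all $a_1,\dots,a_n\in C$.
   Context: Let $\Bbbk$ be a field of characteristic $0$ and $H=\Bbbk[D]$ the polynomial algebra, regarded as a Hopf algebra with $\Delta(D)=D\otimes1+1\otimes D$, $\varepsilon(D)=0$, $S(D)=-D$. Sweedler notation: $\Delta(f)=f_{(1)}\otimes f_{(2)}$; iterated coproduct $\Delta^{(1)}=\mathrm{id}_H$, $\Delta^{(k+1)}=(\mathrm{id}_H\otimes\Delta^{(k)})\Delta$. $H$ acts on $H^{\otimes n}$ from the right by $(f_1\otimes\cdots\otimes f_n)h=f_1h_{(1)}\otimes\cdots\otimes f_nh_{(n)}$, and for a left $H$-module $M$ the space $H^{\otimes n}\otimes_H M$ is formed with respect to this action (so $H\otimes_H M\cong M$). A conformal algebra is a unital left $H$-module $C$ with $\Bbbk$-bilinear operations $a_{(n)}b$, $n\ge0$, such that for all $a,b\in C$: $a_{(n)}b=0$ for all sufficiently large $n$; $(Da)_{(n)}b=-n\,a_{(n-1)}b$ and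 $a_{(n)}(Db)=D(a_{(n)}b)+n\,a_{(n-1)}b$. Pseudoproduct: $a*b=\sum_{s\ge0}\frac{(-D)^s}{s!}\otimes1\otimes_H(a_{(s)}b)\in (H\otimes H)\otimes_H C$. Expanded pseudoproduct: for $F\in H^{\otimes n}$, $G\in H^{\otimes m}$, $a,b\in C$ with $a*b=\sum_i f_i\otimes g_i\otimes_H c_i$, set $(F\otimes_H a)*(G\otimes_H b)=\sum_i F\Delta^{(n)}(f_i)\otimes G\Delta^{(m)}(g_i)\otimes_H c_i\in H^{\otimes(n+m)}\otimes_H C$ (extended linearly). Coefficient algebra: $\operatorname{Coeff}C=\Bbbk[t,t^{-1}]\otimes_H C$, where $\Bbbk[t,t^{-1}]$ is a right $H$-module via $t^nD=-nt^{n-1}$; writing $a(n)=t^n\otimes_H a$, the (non-associative in general) multiplication is $a(n)b(m)=\sum_{s\ge0}\binom{n}{s}(a_{(s)}b)(n+m-s)$. Pseudo-form of an identity: write a homogeneous multilinear polynomial as $f(a_1,\dots,a_n)=\sum_{\sigma\in S_n}t_\sigma(a_{1\sigma},\dots,a_{n\sigma})$, where $i\sigma$ is the image of $i$ under $\sigma$ and each $t_\sigma(b_1,\dots,b_n)$ is a linear combination of bracketings of the word $b_1b_2\cdots b_n$ (letters in this order). For a bracketing $t$, $t^*(b_1,\dots,b_n)\in H^{\otimes n}\otimes_H C$ is obtained by replacing every product by the expanded pseudoproduct, each $b_i\in C$ being regarded as $1\otimes_H b_i\in H\otimes_H C$; extend linearly. For $\sigma\in S_n$, $\sigma\otimes_H\mathrm{id}_C$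 denotes the map on $H^{\otimes n}\otimes_H C$ induced by the permutation of tensor factors of $H^{\otimes n}$ sending the $k$-th factor to position $k\sigma$ (so in $(\sigma\otimes_H\mathrm{id}_C)t^*(a_{1\sigma},\dots,a_{n\sigma})$ the factor attached to the argument $a_j$ stands in position $j$). Then $f^*(a_1,\dots,a_n)=\sum_{\sigma}(\sigma\otimes_H\mathrm{id}_C)t^*_\sigma(a_{1\sigma},\dots,a_{n\sigma})$. *)

theory Defs
  imports "HOL-Library.Poly_Mapping" "HOL-Computational_Algebra.Polynomial"
    "HOL-Combinatorics.Permutations"
begin

text \<open>A conformal algebra over a field k of characteristic 0: a k-vector space C
  (scalar multiplication sm) with a linear operator D (the action of the generator
  of H = k[D]) and k-bilinear n-products pr n a b, satisfying locality and the two
  sesquilinearity axioms.\<close>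

definition conformal_algebra ::
  "('k::field_char_0 \<Rightarrow> 'c::ab_group_add \<Rightarrow> 'c) \<Rightarrow> ('c \<Rightarrow> 'c) \<Rightarrow> (nat \<Rightarrow> 'c \<Rightarrow> 'c \<Rightarrow> 'c) \<Rightarrow> bool"
  where
  "conformal_algebra sm D pr \<longleftrightarrow>
     module sm
   \<and> (\<forall>x y. D (x + y) = D x + D y) \<and> (\<forall>k x. D (sm k x) = sm k (D x))
   \<and> (\<forall>n a b c. pr n (a + b) c = pr n a c + pr n b c)
   \<and> (\<forall>n a b c. pr n a (b + c) = pr n a b + pr n a c)
   \<and> (\<forall>n k a b. pr n (sm k a) b = sm k (pr n a b))
   \<and> (\<forall>n k a b. pr n a (sm k b) = sm k (pr n a b))
   \<and> (\<forall>a b. \<exists>N. \<forall>n\<ge>N. pr n a b = 0)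
   \<and> (\<forall>n a b. pr n (D a) b = sm (- of_nat n) (pr (n - 1) a b))
   \<and> (\<forall>n a b. pr n a (D b) = D (pr n a b) + sm (of_nat n) (pr (n - 1) a b))"

definition hact :: "('k::field_char_0 \<Rightarrow> 'c::ab_group_add \<Rightarrow> 'c) \<Rightarrow> ('c \<Rightarrow> 'c) \<Rightarrow> 'k poly \<Rightarrow> 'c \<Rightarrow> 'c"
  where "hact sm D h c = (\<Sum>i\<le>Polynomial.degree h. sm (Polynomial.coeff h i) ((D ^^ i) c))"

definition bnd :: "(nat \<Rightarrow> 'c \<Rightarrow> 'c \<Rightarrow> 'c::zero) \<Rightarrow> 'c \<Rightarrow> 'c \<Rightarrow> nat"
  where "bnd pr a b = (LEAST N. \<forall>s\<ge>N. pr s a b = 0)"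

datatype btree = Lf | Nd btree btree

fun nleaves :: "btree \<Rightarrow> nat" where
  "nleaves Lf = 1"
| "nleaves (Nd l r) = nleaves l + nleaves r"

fun evalT :: "('a \<Rightarrow> 'a \<Rightarrow> 'a) \<Rightarrow> btree \<Rightarrow> (nat \<Rightarrow> 'a) \<Rightarrow> nat \<Rightarrow> 'a" where
  "evalT m Lf g i = g i"
| "evalT m (Nd l r) g i = m (evalT m l g i) (evalT m r g (i + nleaves l))"

section \<open>The coefficient algebra Coeff C = k[t,t^-1] \<otimes>_H C\<close>

text \<open>An element of k[t,t^-1] \<otimes>_k C is represented by a finite list of pairs (m, c),
  standing for the sum of the t^m \<otimes> c.  Its coefficient function: \<close>
definition coeffL :: "(int \<times> 'c::ab_group_add) list \<Rightarrow> int \<Rightarrow> 'c"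
  where "coeffL P k = sum_list (map snd (filter (\<lambda>(m, c). m = k) P))"

text \<open>Relation t^m h \<otimes> c - t^m \<otimes> h c, using t^m D^i = (-1)^i i! (m choose i) t^(m-i).\<close>
definition relC :: "('k::field_char_0 \<Rightarrow> 'c::ab_group_add \<Rightarrow> 'c) \<Rightarrow> ('c \<Rightarrow> 'c)
    \<Rightarrow> int \<times> 'k poly \<times> 'c \<Rightarrow> (int \<times> 'c) list"
  where "relC sm D r = (case r of (m, h, c) \<Rightarrow>
     map (\<lambda>i. (m - int i, sm (Polynomial.coeff h i * (-1) ^ i * fact i * ((of_int m :: 'k) gchoose i)) c))
         [0..<Suc (Polynomial.degree h)]
     @ [(m, - hact sm D h c)])"

text \<open>An element of k[t,t^-1] \<otimes>_k C is zero in Coeff C iff it lies in the span of relations.\<close>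
definition zeroC :: "('k::field_char_0 \<Rightarrow> 'c::ab_group_add \<Rightarrow> 'c) \<Rightarrow> ('c \<Rightarrow> 'c)
    \<Rightarrow> (int \<Rightarrow> 'c) \<Rightarrow> bool"
  where "zeroC sm D \<Phi> \<longleftrightarrow> (\<exists>R :: (int \<times> 'k poly \<times> 'c) list. \<Phi> = coeffL (concat (map (relC sm D) R)))"

definition prodC :: "('k::field_char_0 \<Rightarrow> 'c::ab_group_add \<Rightarrow> 'c) \<Rightarrow> (nat \<Rightarrow> 'c \<Rightarrow> 'c \<Rightarrow> 'c)
    \<Rightarrow> (int \<times> 'c) list \<Rightarrow> (int \<times> 'c) list \<Rightarrow> (int \<times> 'c) list"
  where "prodC sm pr P Q = concat (map (\<lambda>(n, a). concat (map (\<lambda>(m, b).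
      map (\<lambda>s. (n + m - int s, sm ((of_int n :: 'k) gchoose s) (pr s a b))) [0..<bnd pr a b]) Q)) P)"

definition scaleL :: "('k \<Rightarrow> 'c \<Rightarrow> 'c) \<Rightarrow> 'k \<Rightarrow> ('x \<times> 'c) list \<Rightarrow> ('x \<times> 'c) list"
  where "scaleL sm a P = map (\<lambda>(m, x). (m, sm a x)) P"

text \<open>H^{\<otimes> n} = k[x_0, ..., x_(n-1)], x_j being D in the j-th tensor factor.\<close>
type_synonym 'k mpoly = "(nat \<Rightarrow>\<^sub>0 nat) \<Rightarrow>\<^sub>0 'k"

definition var :: "nat \<Rightarrow> 'k::comm_ring_1 mpoly"
  where "var j = Poly_Mapping.single (Poly_Mapping.single j 1) 1"

definition cst :: "'k::comm_ring_1 \<Rightarrow> 'k mpoly"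
  where "cst a = Poly_Mapping.single 0 a"

text \<open>Elements of H^{\<otimes> n} \<otimes>_k C: finite lists of pairs (F, c) standing for the sum of F \<otimes> c;
  coefficient function with respect to the monomial basis of H^{\<otimes> n}.\<close>
definition coeffP :: "('k::comm_ring_1 \<Rightarrow> 'c::ab_group_add \<Rightarrow> 'c) \<Rightarrow> ('k mpoly \<times> 'c) list
    \<Rightarrow> (nat \<Rightarrow>\<^sub>0 nat) \<Rightarrow> 'c"
  where "coeffP sm P \<gamma> = sum_list (map (\<lambda>(F, c). sm (Poly_Mapping.lookup F \<gamma>) c) P)"

definition deltaH :: "nat \<Rightarrow> 'k::comm_ring_1 poly \<Rightarrow> 'k mpoly"
  where "deltaH n h = (\<Sum>i\<le>Polynomial.degree h. cst (Polynomial.coeff h i) * (\<Sum>j<n. var j) ^ i)"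

text \<open>Relation G h \<otimes> c - G \<otimes> h c for the right H-action on H^{\<otimes> n}.\<close>
definition relH :: "('k::field_char_0 \<Rightarrow> 'c::ab_group_add \<Rightarrow> 'c) \<Rightarrow> ('c \<Rightarrow> 'c) \<Rightarrow> nat
    \<Rightarrow> 'k mpoly \<times> 'k poly \<times> 'c \<Rightarrow> ('k mpoly \<times> 'c) list"
  where "relH sm D n r = (case r of (G, h, c) \<Rightarrow> [(G * deltaH n h, c), (G, - hact sm D h c)])"

text \<open>An element of H^{\<otimes> n} \<otimes>_k C (given by its coefficient function) is zero in
  H^{\<otimes> n} \<otimes>_H C iff it lies in the span of the relations.\<close>
definition zeroH :: "('k::field_char_0 \<Rightarrow> 'c::ab_group_add \<Rightarrow> 'c) \<Rightarrow> ('c \<Rightarrow> 'c) \<Rightarrow> nat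
    \<Rightarrow> ((nat \<Rightarrow>\<^sub>0 nat) \<Rightarrow> 'c) \<Rightarrow> bool"
  where "zeroH sm D n \<Phi> \<longleftrightarrow> (\<exists>R :: ('k mpoly \<times> 'k poly \<times> 'c) list.
      (\<forall>(G, h, c) \<in> set R. \<forall>\<mu> \<in> Poly_Mapping.keys G. Poly_Mapping.keys \<mu> \<subseteq> {..<n})
    \<and> \<Phi> = coeffP sm (concat (map (relH sm D n) R)))"

text \<open>Expanded pseudoproduct on representatives; X is Delta^(k)(D) for the left block,
  i.e. the sum of the variables of the left block.
  (F \<otimes> a) * (G \<otimes> b) = sum_s F (-X)^s/s! G \<otimes> a_(s) b.\<close>
definition pprod :: "(nat \<Rightarrow> 'c \<Rightarrow> 'c \<Rightarrow> 'c::ab_group_add) \<Rightarrow> 'k::field_char_0 mpoly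
    \<Rightarrow> ('k mpoly \<times> 'c) list \<Rightarrow> ('k mpoly \<times> 'c) list \<Rightarrow> ('k mpoly \<times> 'c) list"
  where "pprod pr X P Q = concat (map (\<lambda>(F, a). concat (map (\<lambda>(G, b).
      map (\<lambda>s. (F * cst (1 / fact s) * (- X) ^ s * G, pr s a b)) [0..<bnd pr a b]) Q)) P)"

text \<open>t^* for a bracketing t applied to the word a i, a (i+1), ...; the letter in
  position j carries the tensor factor (variable) x_j.\<close>
fun starT :: "(nat \<Rightarrow> 'c \<Rightarrow> 'c \<Rightarrow> 'c::ab_group_add) \<Rightarrow> btree \<Rightarrow> (nat \<Rightarrow> 'c) \<Rightarrow> nat
    \<Rightarrow> ('k::field_char_0 mpoly \<times> 'c) list" where
  "starT pr Lf a i = [(1, a i)]"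
| "starT pr (Nd l r) a i =
     pprod pr (\<Sum>j\<in>{i..<i + nleaves l}. var j) (starT pr l a i) (starT pr r a (i + nleaves l))"

text \<open>sigma \<otimes>_H id: the k-th tensor factor goes to position sigma k, i.e. the
  substitution x_k := x_(sigma k).\<close>
definition ren_mon :: "(nat \<Rightarrow> nat) \<Rightarrow> (nat \<Rightarrow>\<^sub>0 nat) \<Rightarrow> (nat \<Rightarrow>\<^sub>0 nat)"
  where "ren_mon \<sigma> \<mu> = (\<Sum>k\<in>Poly_Mapping.keys \<mu>. Poly_Mapping.single (\<sigma> k) (Poly_Mapping.lookup \<mu> k))"

definition ren :: "(nat \<Rightarrow> nat) \<Rightarrow> 'k::comm_ring_1 mpoly \<Rightarrow> 'k mpoly"
  where "ren \<sigma> F = (\<Sum>\<mu>\<in>Poly_Mapping.keys F. Poly_Mapping.single (ren_mon \<sigma> \<mu>) (Poly_Mapping.lookup F \<mu>))"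

definition perm_tensor :: "(nat \<Rightarrow> nat) \<Rightarrow> ('k::comm_ring_1 mpoly \<times> 'c) list \<Rightarrow> ('k mpoly \<times> 'c) list"
  where "perm_tensor \<sigma> P = map (\<lambda>(F, c). (ren \<sigma> F, c)) P"

end

theory Submission
  imports Defs
begin

text \<open>Identify $H^{\otimes n}$ with $k[x_0,\dots,x_{n-1}]$. Evaluating $f$ in the
  coefficient algebra at $a_j(k_j)$ amounts to applying $f^*$ to the monomial
  $\prod_j t_j^{k_j}$, with $x_j$ acting as $-d/dt_j$, and then setting all $t_j = t$.
  Modulo the action of $H$ the last variable can be eliminated, so $f^*$ is represented by
  $\sum_\gamma x^\gamma\otimes c_\gamma$ with $\gamma$ involving only the first $n-1$ variables.
  Choosing $k=(\gamma_0,\dots,\gamma_{n-2},-1)$ and using that $c\mapsto c(-1)$ is injective,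
  induction on the degree of $\gamma$ gives $c_\gamma=0$.\<close>

text \<open>Hypothesis and conclusion both say that an element lies in a span of relations, and no
  quotient space is formed. So the hypothesis is used through maps into C that kill the relations,
  while the conclusion needs relations to be exhibited. Injectivity of c \<mapsto> c(-1) enters as
  an explicit left inverse \<open>phi\<close>; combined with the differentiation of \<Prod>
  t_j^{k_j} it gives the family \<open>evP phi k\<close>, one C-valued map for each exponent vector
  k. The exponent -1 for the eliminated variable is forced by injectivity: (D c)(0) = 0 for every c,
  and c(-2) = (D c)(-1) vanishes when D c = 0. The other exponents are nonnegative, so that
  differentiating too often gives 0; this makes the system for the coefficients triangular. Its
  diagonal entries are products of factorials up to sign, invertible in characteristic 0.\<close>

lemma poly_mapping_eq_sum_single:
  "F = (\<Sum>\<mu>\<in>Poly_Mapping.keys F. Poly_Mapping.single \<mu> (Poly_Mapping.lookup F \<mu>))"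
proof (rule poly_mapping_eqI)
  fix \<nu>
  show "Poly_Mapping.lookup F \<nu> =
      Poly_Mapping.lookup (\<Sum>\<mu>\<in>Poly_Mapping.keys F. Poly_Mapping.single \<mu> (Poly_Mapping.lookup F \<mu>)) \<nu>"
    by (simp add: lookup_sum lookup_single when_def in_keys_iff)
qed

section \<open>Variables of a polynomial\<close>

definition vars_in :: "nat set \<Rightarrow> 'k::zero mpoly \<Rightarrow> bool"
  where "vars_in B F \<longleftrightarrow> (\<forall>\<mu>\<in>Poly_Mapping.keys F. Poly_Mapping.keys \<mu> \<subseteq> B)"

lemma vars_in_mono: "vars_in A F \<Longrightarrow> A \<subseteq> B \<Longrightarrow> vars_in B F"
  by (auto simp: vars_in_def)

lemma vars_in_zero [simp]: "vars_in B 0"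
  by (simp add: vars_in_def)

lemma vars_in_single: "Poly_Mapping.keys \<mu> \<subseteq> B \<Longrightarrow> vars_in B (Poly_Mapping.single \<mu> a)"
  by (simp add: vars_in_def)

lemma vars_in_one [simp]: "vars_in B (1 :: 'k::comm_ring_1 mpoly)"
  by (simp add: vars_in_def)

lemma vars_in_cst [simp]: "vars_in B (cst a)"
  by (simp add: cst_def vars_in_single)

lemma vars_in_var: "j \<in> B \<Longrightarrow> vars_in B (var j)"
  by (simp add: var_def vars_in_single)

lemma vars_in_uminus [simp]: "vars_in B (- F) \<longleftrightarrow> vars_in B (F :: 'k::comm_ring_1 mpoly)"
  by (simp add: vars_in_def in_keys_iff)

lemma vars_in_add:
  fixes F G :: "'k::comm_ring_1 mpoly"
  shows "vars_in B F \<Longrightarrow> vars_in B G \<Longrightarrow> vars_in B (F + G)"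
  unfolding vars_in_def using keys_add[of F G] by blast

lemma vars_in_mult:
  fixes F G :: "'k::comm_ring_1 mpoly"
  assumes "vars_in B F" "vars_in B G"
  shows "vars_in B (F * G)"
  unfolding vars_in_def
proof
  fix \<mu> assume "\<mu> \<in> Poly_Mapping.keys (F * G)"
  then obtain \<alpha> \<beta> where "\<mu> = \<alpha> + \<beta>" "\<alpha> \<in> Poly_Mapping.keys F" "\<beta> \<in> Poly_Mapping.keys G"
    using keys_mult[of F G] by blast
  then show "Poly_Mapping.keys \<mu> \<subseteq> B"
    using assms keys_add[of \<alpha> \<beta>] unfolding vars_in_def by blast
qed

lemma vars_in_sum:
  fixes F :: "'i \<Rightarrow> 'k::comm_ring_1 mpoly"
  shows "(\<And>i. i \<in> I \<Longrightarrow> vars_in B (F i)) \<Longrightarrow> vars_in B (\<Sum>i\<in>I. F i)"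
  by (induction I rule: infinite_finite_induct) (auto intro: vars_in_add)

lemma vars_in_power:
  fixes F :: "'k::comm_ring_1 mpoly"
  shows "vars_in B F \<Longrightarrow> vars_in B (F ^ s)"
  by (induction s) (auto intro: vars_in_mult)

text \<open>The two subtrees of a node use disjoint blocks of variables. Hence the derivatives for
  one subtree do not touch the powers belonging to the other, and weights and exponents split over a
  product.\<close>

lemma vars_in_starT:
  "(F, c) \<in> set (starT pr t a i) \<Longrightarrow> vars_in {i..<i + nleaves t} (F :: 'k::field_char_0 mpoly)"
proof (induction t arbitrary: i F c)
  case Lf
  then show ?case by simp
next
  case (Nd l r)
  let ?B = "{i..<i + nleaves (Nd l r)}"
  let ?X = "\<Sum>j\<in>{i..<i + nleaves l}. var j :: 'k mpoly"
  from Nd.prems obtain G H b d s where G: "(G, b) \<in> set (starT pr l a i)"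
    and H: "(H, d) \<in> set (starT pr r a (i + nleaves l))"
    and F: "F = G * cst (1 / fact s) * (- ?X) ^ s * H"
    by (simp add: pprod_def) blast
  have "vars_in ?B G" "vars_in ?B H"
    using Nd.IH(1)[OF G] Nd.IH(2)[OF H] by (auto elim!: vars_in_mono)
  moreover have "vars_in ?B (- ?X)"
    unfolding vars_in_uminus by (intro vars_in_sum vars_in_var) auto
  ultimately show ?case
    unfolding F by (intro vars_in_mult vars_in_power vars_in_cst)
qed

section \<open>Iterated derivatives of products of powers\<close>

text \<open>In $k[t_j^{\pm1}]$ with $x_j$ acting as $-d/dt_j$, the monomial $x^\mu$ sends
  $\prod_{j\in B} t_j^{k_j}$ to \<open>wt k B \<mu>\<close> times a monomial which becomes $t$ to the
  power \<open>expo k B \<mu>\<close> when all $t_j$ are identified with $t$.\<close>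

definition wt :: "(nat \<Rightarrow> int) \<Rightarrow> nat set \<Rightarrow> (nat \<Rightarrow>\<^sub>0 nat) \<Rightarrow> 'k::field_char_0"
  where "wt k B \<mu> = (\<Prod>j\<in>B. pochhammer (- of_int (k j)) (Poly_Mapping.lookup \<mu> j))"

definition expo :: "(nat \<Rightarrow> int) \<Rightarrow> nat set \<Rightarrow> (nat \<Rightarrow>\<^sub>0 nat) \<Rightarrow> int"
  where "expo k B \<mu> = (\<Sum>j\<in>B. k j - int (Poly_Mapping.lookup \<mu> j))"

abbreviation unit_mon :: "nat \<Rightarrow> nat \<Rightarrow>\<^sub>0 nat"
  where "unit_mon j \<equiv> Poly_Mapping.single j 1"

text \<open>One more application of -d/dt_j meets the current power t_j^{k_j - \<mu>_j} and brings
  down minus its exponent.\<close>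

lemma wt_add_unit:
  assumes "finite B" "j \<in> B"
  shows "(wt k B (\<mu> + unit_mon j) :: 'k::field_char_0) =
    - of_int (k j - int (Poly_Mapping.lookup \<mu> j)) * wt k B \<mu>"
proof -
  have "(\<Prod>i\<in>B - {j}. pochhammer (- of_int (k i) :: 'k) (Poly_Mapping.lookup (\<mu> + unit_mon j) i))
      = (\<Prod>i\<in>B - {j}. pochhammer (- of_int (k i)) (Poly_Mapping.lookup \<mu> i))"
    by (rule prod.cong) (auto simp: lookup_add lookup_single)
  then show ?thesis
    using assms by (simp add: wt_def prod.remove[of B j] lookup_add pochhammer_Suc algebra_simps)
qed

lemma expo_add_unit:
  assumes "finite B" "j \<in> B"
  shows "expo k B (\<mu> + unit_mon j) = expo k B \<mu> - 1"
proof -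
  have "(\<Sum>i\<in>B - {j}. k i - int (Poly_Mapping.lookup (\<mu> + unit_mon j) i))
      = (\<Sum>i\<in>B - {j}. k i - int (Poly_Mapping.lookup \<mu> i))"
    by (rule sum.cong) (auto simp: lookup_add lookup_single)
  then show ?thesis
    using assms by (simp add: expo_def sum.remove[of B j] lookup_add algebra_simps)
qed

lemma lookup_outside: "Poly_Mapping.keys \<nu> \<subseteq> A \<Longrightarrow> j \<notin> A \<Longrightarrow> Poly_Mapping.lookup \<nu> j = 0"
  by (auto simp: in_keys_iff)

lemma expo_add_outside:
  assumes "Poly_Mapping.keys \<nu> \<subseteq> A" "A \<inter> B = {}"
  shows "expo k B (\<mu> + \<nu>) = expo k B \<mu>"
proof -
  have "Poly_Mapping.lookup \<nu> j = 0" if "j \<in> B" for j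
    using lookup_outside[OF assms(1)] assms(2) that by blast
  then show ?thesis
    unfolding expo_def by (intro sum.cong) (auto simp: lookup_add)
qed

lemma wt_add_outside:
  assumes "Poly_Mapping.keys \<nu> \<subseteq> A" "A \<inter> B = {}"
  shows "wt k B (\<mu> + \<nu>) = wt k B \<mu>"
proof -
  have "Poly_Mapping.lookup \<nu> j = 0" if "j \<in> B" for j
    using lookup_outside[OF assms(1)] assms(2) that by blast
  then show ?thesis
    unfolding wt_def by (intro prod.cong) (auto simp: lookup_add)
qed

lemma expo_union:
  assumes "finite A" "finite B" "A \<inter> B = {}"
    and "Poly_Mapping.keys \<mu> \<subseteq> A" "Poly_Mapping.keys \<nu> \<subseteq> B"
  shows "expo k (A \<union> B) (\<mu> + \<nu>) = expo k A \<mu> + expo k B \<nu>"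
proof -
  have "expo k (A \<union> B) (\<mu> + \<nu>) = expo k A (\<mu> + \<nu>) + expo k B (\<nu> + \<mu>)"
    using assms(1-3) by (simp add: expo_def sum.union_disjoint add.commute)
  then show ?thesis
    using assms by (simp add: expo_add_outside Int_commute)
qed

lemma wt_union:
  assumes "finite A" "finite B" "A \<inter> B = {}"
    and "Poly_Mapping.keys \<mu> \<subseteq> A" "Poly_Mapping.keys \<nu> \<subseteq> B"
  shows "wt k (A \<union> B) (\<mu> + \<nu>) = wt k A \<mu> * wt k B \<nu>"
proof -
  have "wt k (A \<union> B) (\<mu> + \<nu>) = wt k A (\<mu> + \<nu>) * wt k B (\<nu> + \<mu>)"
    using assms(1-3) by (simp add: wt_def prod.union_disjoint add.commute)
  then show ?thesis
    using assms by (simp add: wt_add_outside Int_commute)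
qed

lemma lookup_ren_mon:
  assumes "inj \<sigma>"
  shows "Poly_Mapping.lookup (ren_mon \<sigma> \<mu>) (\<sigma> j) = Poly_Mapping.lookup \<mu> j"
  by (simp add: ren_mon_def lookup_sum lookup_single when_def inj_eq[OF assms] in_keys_iff)

lemma wt_ren_mon:
  assumes "\<sigma> permutes B"
  shows "wt k B (ren_mon \<sigma> \<mu>) = wt (k \<circ> \<sigma>) B \<mu>"
  unfolding wt_def
  by (subst prod.permute[OF assms]) (simp add: lookup_ren_mon permutes_inj[OF assms])

lemma expo_ren_mon:
  assumes "\<sigma> permutes B"
  shows "expo k B (ren_mon \<sigma> \<mu>) = expo (k \<circ> \<sigma>) B \<mu>"
  unfolding expo_def
  by (subst sum.permute[OF assms]) (simp add: lookup_ren_mon permutes_inj[OF assms])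

lemma vars_in_ren:
  assumes "\<sigma> permutes B" "vars_in B F"
  shows "vars_in B (ren \<sigma> F)"
  unfolding ren_def
proof (intro vars_in_sum vars_in_single)
  fix \<mu> assume \<mu>: "\<mu> \<in> Poly_Mapping.keys F"
  have "Poly_Mapping.lookup (ren_mon \<sigma> \<mu>) j = 0" if "j \<notin> B" for j
  proof -
    have "Poly_Mapping.lookup (ren_mon \<sigma> \<mu>) (\<sigma> j) = Poly_Mapping.lookup \<mu> j"
      by (rule lookup_ren_mon[OF permutes_inj[OF assms(1)]])
    also have "\<dots> = 0"
      using assms(2) \<mu> that by (intro lookup_outside) (auto simp: vars_in_def)
    finally show ?thesis
      using assms(1) that by (simp add: permutes_not_in)
  qed
  then show "Poly_Mapping.keys (ren_mon \<sigma> \<mu>) \<subseteq> B"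
    by (auto simp: in_keys_iff)
qed

section \<open>Linear extension from monomials\<close>

locale mpoly_lin = module scale
  for scale :: "'k::comm_ring_1 \<Rightarrow> 'c::ab_group_add \<Rightarrow> 'c" (infixr \<open>*s\<close> 75)
begin

definition lin :: "'k mpoly \<Rightarrow> ((nat \<Rightarrow>\<^sub>0 nat) \<Rightarrow> 'c) \<Rightarrow> 'c"
  where "lin F h = (\<Sum>\<mu>\<in>Poly_Mapping.keys F. Poly_Mapping.lookup F \<mu> *s h \<mu>)"

lemma lin_superset:
  assumes "finite S" "Poly_Mapping.keys F \<subseteq> S"
  shows "lin F h = (\<Sum>\<mu>\<in>S. Poly_Mapping.lookup F \<mu> *s h \<mu>)"
  unfolding lin_def using assms by (intro sum.mono_neutral_left) (auto simp: in_keys_iff)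

lemma lin_zero [simp]: "lin 0 h = 0"
  by (simp add: lin_def)

lemma lin_single [simp]: "lin (Poly_Mapping.single \<mu> a) h = a *s h \<mu>"
  by (simp add: lin_superset[of "{\<mu>}"])

lemma lin_one [simp]: "lin 1 h = h 0"
  using lin_single[of 0 1 h] by simp

lemma lin_cst [simp]: "lin (cst a) h = a *s h 0"
  by (simp add: cst_def)

lemma lin_var [simp]: "lin (var j) h = h (unit_mon j)"
  by (simp add: var_def)

lemma lin_add: "lin (F + G) h = lin F h + lin G h"
proof -
  let ?S = "Poly_Mapping.keys F \<union> Poly_Mapping.keys G"
  show ?thesis
    using keys_add[of F G]
    by (simp add: lin_superset[of ?S] lookup_add scale_left_distrib sum.distrib)
qed

lemma lin_sum: "lin (\<Sum>i\<in>I. F i) h = (\<Sum>i\<in>I. lin (F i) h)"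
  by (induction I rule: infinite_finite_induct) (auto simp: lin_add)

lemma lin_cong:
  "(\<And>\<mu>. \<mu> \<in> Poly_Mapping.keys F \<Longrightarrow> g \<mu> = h \<mu>) \<Longrightarrow> lin F g = lin F h"
  by (simp add: lin_def)

lemma lin_add_right: "lin F (\<lambda>\<mu>. g \<mu> + h \<mu>) = lin F g + lin F h"
  by (simp add: lin_def scale_right_distrib sum.distrib)

lemma lin_zero_right [simp]: "lin F (\<lambda>\<mu>. 0) = 0"
  by (simp add: lin_def)

lemma lin_scale_right: "lin F (\<lambda>\<mu>. a *s h \<mu>) = a *s lin F h"
  by (simp add: lin_def scale_sum_right mult.commute)

lemma lin_sum_right: "lin F (\<lambda>\<mu>. \<Sum>i\<in>I. h i \<mu>) = (\<Sum>i\<in>I. lin F (h i))"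
  by (induction I rule: infinite_finite_induct) (auto simp: lin_add_right)

lemma lin_sum_list_right: "lin F (\<lambda>\<mu>. \<Sum>x\<leftarrow>xs. h x \<mu>) = (\<Sum>x\<leftarrow>xs. lin F (h x))"
  by (induction xs) (auto simp: lin_add_right)

lemma lin_mult: "lin (F * G) h = lin F (\<lambda>\<mu>. lin G (\<lambda>\<nu>. h (\<mu> + \<nu>)))"
proof -
  have "F * G = (\<Sum>\<mu>\<in>Poly_Mapping.keys F. \<Sum>\<nu>\<in>Poly_Mapping.keys G.
      Poly_Mapping.single (\<mu> + \<nu>) (Poly_Mapping.lookup F \<mu> * Poly_Mapping.lookup G \<nu>))"
    using arg_cong2[OF poly_mapping_eq_sum_single[of F] poly_mapping_eq_sum_single[of G], of "(*)"]
    unfolding sum_product mult_single .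
  then have "lin (F * G) h = (\<Sum>\<mu>\<in>Poly_Mapping.keys F. \<Sum>\<nu>\<in>Poly_Mapping.keys G.
      (Poly_Mapping.lookup F \<mu> * Poly_Mapping.lookup G \<nu>) *s h (\<mu> + \<nu>))"
    by (simp add: lin_sum)
  then show ?thesis
    by (simp add: lin_def scale_sum_right)
qed

lemma lin_ren: "lin (ren \<sigma> F) h = lin F (\<lambda>\<mu>. h (ren_mon \<sigma> \<mu>))"
  by (simp add: ren_def lin_sum lin_def[of F])

end

section \<open>Linear maps on representatives, and the Leibniz rule\<close>

locale conformal = mpoly_lin sm
  for sm :: "'k::field_char_0 \<Rightarrow> 'c::ab_group_add \<Rightarrow> 'c" (infixr \<open>*s\<close> 75) +
  fixes D :: "'c \<Rightarrow> 'c" and pr :: "nat \<Rightarrow> 'c \<Rightarrow> 'c \<Rightarrow> 'c"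
  assumes conf: "conformal_algebra sm D pr"
begin

abbreviation linear :: "('c \<Rightarrow> 'c) \<Rightarrow> bool"
  where "linear \<equiv> module_hom sm sm"

lemma linear_iff: "linear T \<longleftrightarrow> (\<forall>x y. T (x + y) = T x + T y) \<and> (\<forall>a x. T (a *s x) = a *s T x)"
  by (simp add: module_hom_iff module_axioms)

lemma linear_D: "linear D"
  using conf by (simp add: linear_iff conformal_algebra_def)

lemma linear_D_funpow: "linear (D ^^ i)"
  using linear_D by (induction i) (auto simp: linear_iff)

lemma pr_add_left: "pr s (a + b) c = pr s a c + pr s b c"
  and pr_add_right: "pr s a (b + c) = pr s a b + pr s a c"
  and pr_scale_left: "pr s (x *s a) b = x *s pr s a b"
  and pr_scale_right: "pr s a (x *s b) = x *s pr s a b"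
  using conf by (auto simp: conformal_algebra_def)

lemma pr_eq_0:
  assumes "bnd pr a b \<le> s"
  shows "pr s a b = 0"
proof -
  have "\<exists>N. \<forall>s\<ge>N. pr s a b = 0"
    using conf by (auto simp: conformal_algebra_def)
  then have "\<forall>s\<ge>bnd pr a b. pr s a b = 0"
    unfolding bnd_def by (rule LeastI_ex)
  then show ?thesis
    using assms by blast
qed

text \<open>For \<open>\<Theta> m\<close> linear in c this is the linear map on k[t,t^-1] \<otimes>
  C with t^m \<otimes> c \<mapsto> \<open>\<Theta> m c\<close>; \<open>sumP\<close> is its analogue
  for monomials x^\<mu>. Lists are kept as arguments because \<open>prodC\<close> and
  \<open>pprod\<close> are defined on them.\<close>

definition sumC :: "(int \<Rightarrow> 'c \<Rightarrow> 'c) \<Rightarrow> (int \<times> 'c) list \<Rightarrow> 'c"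
  where "sumC \<Theta> P = (\<Sum>(m, c)\<leftarrow>P. \<Theta> m c)"

definition sumP :: "((nat \<Rightarrow>\<^sub>0 nat) \<Rightarrow> 'c \<Rightarrow> 'c) \<Rightarrow> ('k mpoly \<times> 'c) list \<Rightarrow> 'c"
  where "sumP \<Xi> P = (\<Sum>(F, c)\<leftarrow>P. lin F (\<lambda>\<mu>. \<Xi> \<mu> c))"

lemma sumC_simps [simp]:
  "sumC \<Theta> [] = 0" "sumC \<Theta> ((m, c) # P) = \<Theta> m c + sumC \<Theta> P"
  "sumC \<Theta> (P @ Q) = sumC \<Theta> P + sumC \<Theta> Q"
  by (simp_all add: sumC_def)

lemma sumP_simps [simp]:
  "sumP \<Xi> [] = 0" "sumP \<Xi> ((F, c) # P) = lin F (\<lambda>\<mu>. \<Xi> \<mu> c) + sumP \<Xi> P"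
  "sumP \<Xi> (P @ Q) = sumP \<Xi> P + sumP \<Xi> Q"
  by (simp_all add: sumP_def)

lemma sumC_concat: "sumC \<Theta> (concat Ps) = (\<Sum>P\<leftarrow>Ps. sumC \<Theta> P)"
  by (induction Ps) auto

lemma sumP_concat: "sumP \<Xi> (concat Ps) = (\<Sum>P\<leftarrow>Ps. sumP \<Xi> P)"
  by (induction Ps) auto

lemma linear_sum_list: "linear T \<Longrightarrow> T (\<Sum>x\<leftarrow>xs. g x) = (\<Sum>x\<leftarrow>xs. T (g x))"
  by (induction xs) (auto simp: module_hom.zero module_hom.add)

lemma linear_sum_list_fun:
  "(\<And>x. linear (g x)) \<Longrightarrow> linear (\<lambda>c. \<Sum>x\<leftarrow>xs. g x c)"
  unfolding linear_iff by (induction xs) (simp_all add: scale_right_distrib)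

text \<open>Leibniz rule: the sum of -d/dt_j over j in B, followed by t_j = t, is -d/dt on the block
  product, a power of t of degree \<open>expo k B \<mu>\<close>. The set S may be larger than B
  because the lemma serves twice: for the left block inside a product, and for all variables at once
  in the relations over H.\<close>

lemma lin_power_sum_var:
  fixes g :: "int \<Rightarrow> 'c"
  assumes S: "finite S" and BS: "B \<subseteq> S"
  shows "lin ((\<Sum>j\<in>B. var j) ^ s) (\<lambda>\<nu>. wt k S (\<mu> + \<nu>) *s g (expo k S (\<mu> + \<nu>)))
    = (wt k S \<mu> * pochhammer (- of_int (expo k B \<mu>)) s) *s g (expo k S \<mu> - int s)"
proof (induction s arbitrary: \<mu>)
  case 0
  then show ?case by simp
next
  case (Suc s)
  have B: "finite B"
    using S BS by (rule rev_finite_subset)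
  let ?h = "\<lambda>\<nu>. wt k S \<nu> *s g (expo k S \<nu>)"
  let ?g = "g (expo k S \<mu> - int (Suc s))"
  let ?p = "pochhammer (- of_int (expo k B \<mu>) + 1) s :: 'k"
  have "lin ((\<Sum>j\<in>B. var j) ^ Suc s) (\<lambda>\<nu>. ?h (\<mu> + \<nu>))
      = (\<Sum>j\<in>B. lin ((\<Sum>j\<in>B. var j) ^ s) (\<lambda>\<nu>. ?h ((\<mu> + unit_mon j) + \<nu>)))"
    by (simp add: lin_mult lin_sum add.assoc)
  also have "\<dots> = (\<Sum>j\<in>B. (wt k S (\<mu> + unit_mon j)
      * pochhammer (- of_int (expo k B (\<mu> + unit_mon j))) s)
      *s g (expo k S (\<mu> + unit_mon j) - int s))"
    by (simp only: Suc.IH)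
  also have "\<dots> = (\<Sum>j\<in>B. (- of_int (k j - int (Poly_Mapping.lookup \<mu> j)) * (wt k S \<mu> * ?p)) *s ?g)"
  proof (rule sum.cong[OF refl])
    fix j assume j: "j \<in> B"
    then have "j \<in> S"
      using BS by blast
    have *: "- of_int (expo k B \<mu> - 1) = (- of_int (expo k B \<mu>) + 1 :: 'k)"
      "expo k S \<mu> - 1 - int s = expo k S \<mu> - int (Suc s)"
      by simp_all
    show "(wt k S (\<mu> + unit_mon j) * pochhammer (- of_int (expo k B (\<mu> + unit_mon j))) s)
        *s g (expo k S (\<mu> + unit_mon j) - int s)
      = (- of_int (k j - int (Poly_Mapping.lookup \<mu> j)) * (wt k S \<mu> * ?p)) *s ?g"
      unfolding wt_add_unit[OF S \<open>j \<in> S\<close>] expo_add_unit[OF S \<open>j \<in> S\<close>] expo_add_unit[OF B j] *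
      by (simp only: mult.assoc)
  qed
  \<comment> \<open>After identification every j yields the same power of t and the same remaining
    factor, so only the exponents brought down are added; their sum is minus the block degree, the
    first factor of the next Pochhammer symbol.\<close>
  also have "\<dots> = ((\<Sum>j\<in>B. - of_int (k j - int (Poly_Mapping.lookup \<mu> j))) * (wt k S \<mu> * ?p)) *s ?g"
    unfolding scale_sum_left[symmetric] sum_distrib_right[symmetric] ..
  also have "(\<Sum>j\<in>B. - of_int (k j - int (Poly_Mapping.lookup \<mu> j))) = (- of_int (expo k B \<mu>) :: 'k)"
    by (simp add: expo_def flip: sum_negf)
  finally show ?case
    by (simp add: pochhammer_rec mult_ac)
qed

section \<open>Evaluation of bracketings\<close>

text \<open>The summation bound \<open>bnd pr a b\<close> does not depend linearly on a and b, so
  linearity cannot be read off term by term. All sums involved are first extended to a common bound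
  N by vanishing terms.\<close>

lemma linear_prod_term:
  assumes "\<And>m. linear (\<Theta> m)"
  shows "linear (\<lambda>a. \<Sum>s<bnd pr a b. \<Theta> (f s) (g s *s pr s a b))"
    and "linear (\<lambda>b. \<Sum>s<bnd pr a b. \<Theta> (f s) (g s *s pr s a b))"
proof -
  define T where "T N a b = (\<Sum>s<N. \<Theta> (f s) (g s *s pr s a b))" for N a b
  have T: "(\<Sum>s<bnd pr a b. \<Theta> (f s) (g s *s pr s a b)) = T N a b" if "bnd pr a b \<le> N" for N a b
    unfolding T_def using that
    by (intro sum.mono_neutral_left) (auto simp: pr_eq_0 module_hom.zero[OF assms])
  have T_add: "T N (a + a') b = T N a b + T N a' b" "T N a (b + b') = T N a b + T N a b'"
    and T_scale: "T N (x *s a) b = x *s T N a b" "T N a (x *s b) = x *s T N a b" for N a a' b b' x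
    using assms
    by (simp_all add: T_def pr_add_left pr_add_right pr_scale_left pr_scale_right scale_right_distrib
        sum.distrib scale_sum_right linear_iff mult.commute)
  show "linear (\<lambda>a. \<Sum>s<bnd pr a b. \<Theta> (f s) (g s *s pr s a b))"
    unfolding linear_iff
  proof (intro conjI allI)
    fix a a' x
    define N where "N = Max {bnd pr a b, bnd pr a' b, bnd pr (a + a') b, bnd pr (x *s a) b}"
    have "bnd pr a b \<le> N" "bnd pr a' b \<le> N" "bnd pr (a + a') b \<le> N" "bnd pr (x *s a) b \<le> N"
      by (simp_all add: N_def)
    note * = this[THEN T]
    show "(\<Sum>s<bnd pr (a + a') b. \<Theta> (f s) (g s *s pr s (a + a') b)) =
        (\<Sum>s<bnd pr a b. \<Theta> (f s) (g s *s pr s a b)) + (\<Sum>s<bnd pr a' b. \<Theta> (f s) (g s *s pr s a' b))"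
      unfolding * by (rule T_add)
    show "(\<Sum>s<bnd pr (x *s a) b. \<Theta> (f s) (g s *s pr s (x *s a) b)) =
        x *s (\<Sum>s<bnd pr a b. \<Theta> (f s) (g s *s pr s a b))"
      unfolding * by (rule T_scale)
  qed
  show "linear (\<lambda>b. \<Sum>s<bnd pr a b. \<Theta> (f s) (g s *s pr s a b))"
    unfolding linear_iff
  proof (intro conjI allI)
    fix b b' x
    define N where "N = Max {bnd pr a b, bnd pr a b', bnd pr a (b + b'), bnd pr a (x *s b)}"
    have "bnd pr a b \<le> N" "bnd pr a b' \<le> N" "bnd pr a (b + b') \<le> N" "bnd pr a (x *s b) \<le> N"
      by (simp_all add: N_def)
    note * = this[THEN T]
    show "(\<Sum>s<bnd pr a (b + b'). \<Theta> (f s) (g s *s pr s a (b + b'))) =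
        (\<Sum>s<bnd pr a b. \<Theta> (f s) (g s *s pr s a b)) + (\<Sum>s<bnd pr a b'. \<Theta> (f s) (g s *s pr s a b'))"
      unfolding * by (rule T_add)
    show "(\<Sum>s<bnd pr a (x *s b). \<Theta> (f s) (g s *s pr s a (x *s b))) =
        x *s (\<Sum>s<bnd pr a b. \<Theta> (f s) (g s *s pr s a b))"
      unfolding * by (rule T_scale)
  qed
qed

text \<open>The value of \<Theta> on the product a(n)b(m) in the coefficient algebra.\<close>

definition prod_term :: "(int \<Rightarrow> 'c \<Rightarrow> 'c) \<Rightarrow> int \<Rightarrow> 'c \<Rightarrow> int \<Rightarrow> 'c \<Rightarrow> 'c"
  where "prod_term \<Theta> n a m b =
    (\<Sum>s<bnd pr a b. \<Theta> (n + m - int s) ((of_int n gchoose s) *s pr s a b))"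

lemma linear_prod_term_left: "(\<And>m. linear (\<Theta> m)) \<Longrightarrow> linear (\<lambda>a. prod_term \<Theta> n a m b)"
  and linear_prod_term_right: "(\<And>m. linear (\<Theta> m)) \<Longrightarrow> linear (\<lambda>b. prod_term \<Theta> n a m b)"
  unfolding prod_term_def by (rule linear_prod_term; assumption)+

lemma sumC_prodC:
  "sumC \<Theta> (prodC sm pr P Q) = sumC (\<lambda>n a. sumC (\<lambda>m b. prod_term \<Theta> n a m b) Q) P"
proof -
  have "sumC \<Theta> (map (\<lambda>s. (n + m - int s, (of_int n gchoose s) *s pr s a b)) [0..<bnd pr a b])
      = prod_term \<Theta> n a m b" for n a m b
    by (simp add: sumC_def prod_term_def comp_def interv_sum_list_conv_sum_set_nat atLeast0LessThan)
  then show ?thesis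
    by (simp add: prodC_def sumC_concat sumC_def[of _ P] sumC_def[of _ Q] comp_def case_prod_unfold)
qed

text \<open>Let x^\<mu> act on \<Prod> t_j^{k_j}, set all t_j = t, tensor with c and apply
  \<Theta>.\<close>

definition evP :: "(int \<Rightarrow> 'c \<Rightarrow> 'c) \<Rightarrow> (nat \<Rightarrow> int) \<Rightarrow> nat set \<Rightarrow> (nat \<Rightarrow>\<^sub>0 nat) \<Rightarrow> 'c \<Rightarrow> 'c"
  where "evP \<Theta> k B \<mu> c = wt k B \<mu> *s \<Theta> (expo k B \<mu>) c"

text \<open>The factor (-X)^s/s! of the pseudoproduct acts as (1/s!) d^s/dt^s on the left block
  alone. On a power of degree N = \<open>expo k A \<mu>\<close> this gives N choose s and lowers the
  degree by s, which is exactly the coefficient and the shift in the product of Coeff C.\<close>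

lemma lin_evP_pprod:
  assumes fin: "finite A" "finite B" and disj: "A \<inter> B = {}"
    and F: "vars_in A F" and G: "vars_in B G"
  shows "lin (F * cst (1 / fact s) * (- (\<Sum>j\<in>A. var j)) ^ s * G) (\<lambda>\<mu>. evP \<Theta> k (A \<union> B) \<mu> c)
    = lin F (\<lambda>\<mu>. lin G (\<lambda>\<nu>. (wt k A \<mu> * wt k B \<nu>) *s
        ((of_int (expo k A \<mu>) gchoose s) *s \<Theta> (expo k A \<mu> + expo k B \<nu> - int s) c)))"
proof -
  have *: "(- (\<Sum>j\<in>A. var j)) ^ s = cst ((- 1) ^ s :: 'k) * (\<Sum>j\<in>A. var j) ^ s"
  proof -
    have "- (1 :: 'k mpoly) = cst (- 1)"
      by (simp add: cst_def single_uminus)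
    moreover have "cst (x :: 'k) ^ s = cst (x ^ s)" for x
      by (induction s) (simp_all add: cst_def mult_single)
    ultimately show ?thesis
      by (metis power_minus)
  qed
  have "lin (F * cst (1 / fact s) * (- (\<Sum>j\<in>A. var j)) ^ s * G) (\<lambda>\<mu>. evP \<Theta> k (A \<union> B) \<mu> c)
      = lin (F * (G * (cst ((- 1) ^ s / fact s) * (\<Sum>j\<in>A. var j) ^ s))) (\<lambda>\<mu>. evP \<Theta> k (A \<union> B) \<mu> c)"
  proof -
    have "cst ((- 1) ^ s / fact s) = cst (1 / fact s) * cst ((- 1) ^ s :: 'k)"
      by (simp add: cst_def mult_single)
    then show ?thesis
      unfolding * by (simp only: mult_ac)
  qed
  also have "\<dots> = lin F (\<lambda>\<mu>. lin G (\<lambda>\<nu>. ((- 1) ^ s / fact s) *s lin ((\<Sum>j\<in>A. var j) ^ s)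
      (\<lambda>\<rho>. wt k (A \<union> B) (\<mu> + \<nu> + \<rho>) *s \<Theta> (expo k (A \<union> B) (\<mu> + \<nu> + \<rho>)) c)))"
    by (simp add: lin_mult evP_def add.assoc)
  also have "\<dots> = lin F (\<lambda>\<mu>. lin G (\<lambda>\<nu>. (wt k A \<mu> * wt k B \<nu>) *s
        ((of_int (expo k A \<mu>) gchoose s) *s \<Theta> (expo k A \<mu> + expo k B \<nu> - int s) c)))"
  proof (intro lin_cong)
    fix \<mu> \<nu> assume "\<mu> \<in> Poly_Mapping.keys F" "\<nu> \<in> Poly_Mapping.keys G"
    then have \<mu>: "Poly_Mapping.keys \<mu> \<subseteq> A" and \<nu>: "Poly_Mapping.keys \<nu> \<subseteq> B"
      using F G by (auto simp: vars_in_def)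
    have "expo k A (\<mu> + \<nu>) = expo k A \<mu>"
      using \<nu> disj by (auto intro!: expo_add_outside)
    moreover have "wt k (A \<union> B) (\<mu> + \<nu>) = (wt k A \<mu> * wt k B \<nu> :: 'k)"
      by (rule wt_union[OF fin disj \<mu> \<nu>])
    ultimately show "((- 1) ^ s / fact s) *s lin ((\<Sum>j\<in>A. var j) ^ s)
      (\<lambda>\<rho>. wt k (A \<union> B) (\<mu> + \<nu> + \<rho>) *s \<Theta> (expo k (A \<union> B) (\<mu> + \<nu> + \<rho>)) c)
      = (wt k A \<mu> * wt k B \<nu>) *s
        ((of_int (expo k A \<mu>) gchoose s) *s \<Theta> (expo k A \<mu> + expo k B \<nu> - int s) c)"
      using fin expo_union[OF fin disj \<mu> \<nu>]
      by (subst lin_power_sum_var) (auto simp: gbinomial_pochhammer mult_ac)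
  qed
  finally show ?thesis .
qed

text \<open>The link between the two evaluations. The induction runs over all linear \<Theta>,
  because at a node the rest of the product is absorbed into the functional: the left subtree is
  tested against "multiply by the evaluated right subtree, then apply \<Theta>", and the right
  subtree against \<open>prod_term \<Theta> n c\<close>.\<close>

lemma sumC_evalT:
  assumes "\<And>m. linear (\<Theta> m)"
  shows "sumC \<Theta> (evalT (prodC sm pr) t (\<lambda>j. [(k j, a j)]) i)
    = sumP (evP \<Theta> k {i..<i + nleaves t}) (starT pr t a i)"
  using assms
proof (induction t arbitrary: i \<Theta>)
  case Lf
  then show ?case
    by (simp add: evP_def wt_def expo_def)
next
  case (Nd l r)
  let ?A = "{i..<i + nleaves l}" and ?B = "{i + nleaves l..<i + nleaves l + nleaves r}"
  let ?P = "starT pr l a i :: ('k mpoly \<times> 'c) list"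
  let ?Q = "starT pr r a (i + nleaves l) :: ('k mpoly \<times> 'c) list"
  let ?X = "\<Sum>j\<in>?A. var j :: 'k mpoly"
  let ?pt = "prod_term \<Theta>"
  have AB: "{i..<i + nleaves (Nd l r)} = ?A \<union> ?B"
    by auto
  note lin_l = linear_prod_term_left[OF Nd.prems] and lin_r = linear_prod_term_right[OF Nd.prems]
  have pt: "(\<Sum>s<bnd pr c d. lin (F * cst (1 / fact s) * (- ?X) ^ s * G) (\<lambda>\<mu>. evP \<Theta> k (?A \<union> ?B) \<mu> (pr s c d)))
      = lin F (\<lambda>\<mu>. wt k ?A \<mu> *s lin G (\<lambda>\<nu>. wt k ?B \<nu> *s ?pt (expo k ?A \<mu>) c (expo k ?B \<nu>) d))"
    if "(F, c) \<in> set ?P" "(G, d) \<in> set ?Q" for F c G d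
  proof -
    have "lin (F * cst (1 / fact s) * (- ?X) ^ s * G) (\<lambda>\<mu>. evP \<Theta> k (?A \<union> ?B) \<mu> (pr s c d))
      = lin F (\<lambda>\<mu>. lin G (\<lambda>\<nu>. (wt k ?A \<mu> * wt k ?B \<nu>) *s
        \<Theta> (expo k ?A \<mu> + expo k ?B \<nu> - int s) ((of_int (expo k ?A \<mu>) gchoose s) *s pr s c d)))" for s
      using that by (subst lin_evP_pprod) (auto simp: vars_in_starT module_hom.scale[OF Nd.prems])
    then show ?thesis
      by (simp add: prod_term_def scale_sum_right flip: lin_sum_right lin_scale_right)
  qed
  have "sumC \<Theta> (evalT (prodC sm pr) (Nd l r) (\<lambda>j. [(k j, a j)]) i)
      = sumP (evP (\<lambda>n c. sumC (\<lambda>m d. ?pt n c m d)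
          (evalT (prodC sm pr) r (\<lambda>j. [(k j, a j)]) (i + nleaves l))) k ?A) ?P"
    by (simp add: sumC_prodC, rule Nd.IH(1))
       (auto simp: sumC_def case_prod_unfold intro!: linear_sum_list_fun lin_l)
  also have "\<dots> = sumP (evP (\<lambda>n c. sumP (evP (?pt n c) k ?B) ?Q) k ?A) ?P"
    by (subst Nd.IH(2)) (auto intro: lin_r)
  also have "\<dots> = (\<Sum>(F, c)\<leftarrow>?P. \<Sum>(G, d)\<leftarrow>?Q.
      lin F (\<lambda>\<mu>. wt k ?A \<mu> *s lin G (\<lambda>\<nu>. wt k ?B \<nu> *s ?pt (expo k ?A \<mu>) c (expo k ?B \<nu>) d)))"
    by (simp add: sumP_def evP_def case_prod_unfold flip: lin_sum_list_right)
       (simp add: linear_sum_list[OF module_hom_scale_self])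
  also have "\<dots> = (\<Sum>(F, c)\<leftarrow>?P. \<Sum>(G, d)\<leftarrow>?Q. \<Sum>s<bnd pr c d.
      lin (F * cst (1 / fact s) * (- ?X) ^ s * G) (\<lambda>\<mu>. evP \<Theta> k (?A \<union> ?B) \<mu> (pr s c d)))"
    by (intro arg_cong[where f = sum_list] map_cong refl) (auto simp: pt intro!: arg_cong[where f = sum_list])
  also have "\<dots> = sumP (evP \<Theta> k (?A \<union> ?B)) (pprod pr ?X ?P ?Q)"
    by (simp add: pprod_def sumP_concat comp_def case_prod_unfold sumP_def[of _ "map _ [_..<_]"]
        interv_sum_list_conv_sum_set_nat atLeast0LessThan)
  finally show ?case
    unfolding AB by simp
qed

section \<open>Functionals on the two tensor products\<close>

lemma coeffL_Cons: "coeffL ((m, c) # P) l = (if m = l then c else 0) + coeffL P l"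
  by (simp add: coeffL_def)

lemma coeffL_append: "coeffL (P @ Q) l = coeffL P l + coeffL Q l"
  by (simp add: coeffL_def)

lemma coeffL_concat: "coeffL (concat Ps) l = (\<Sum>P\<leftarrow>Ps. coeffL P l)"
  by (induction Ps) (simp_all add: coeffL_append, simp add: coeffL_def)

lemma coeffP_Nil [simp]: "coeffP sm [] \<gamma> = 0"
  and coeffP_Cons: "coeffP sm ((F, c) # P) \<gamma> = Poly_Mapping.lookup F \<gamma> *s c + coeffP sm P \<gamma>"
  and coeffP_append: "coeffP sm (P @ Q) \<gamma> = coeffP sm P \<gamma> + coeffP sm Q \<gamma>"
  by (simp_all add: coeffP_def)

lemma coeffP_concat: "coeffP sm (concat Ps) \<gamma> = (\<Sum>P\<leftarrow>Ps. coeffP sm P \<gamma>)"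
  by (induction Ps) (simp_all add: coeffP_append)

lemma sumC_eq_sum_coeffL:
  assumes "\<And>m. linear (\<Theta> m)" "finite S" "fst ` set P \<subseteq> S"
  shows "sumC \<Theta> P = (\<Sum>m\<in>S. \<Theta> m (coeffL P m))"
  using assms(3)
proof (induction P)
  case Nil
  then show ?case
    by (simp add: coeffL_def module_hom.zero[OF assms(1)])
next
  case (Cons x P)
  obtain m c where x: "x = (m, c)"
    by (cases x)
  have "(\<Sum>l\<in>S. \<Theta> l (coeffL (x # P) l))
      = (\<Sum>l\<in>S. (if m = l then \<Theta> l c else 0) + \<Theta> l (coeffL P l))"
    by (intro sum.cong) (auto simp: x coeffL_Cons module_hom.add[OF assms(1)] module_hom.zero[OF assms(1)])
  then show ?case
    using Cons assms(2) by (simp add: x sum.distrib)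
qed

text \<open>\<open>zeroC\<close> sees only coefficient functions, so \<open>sumC\<close> has to be
  independent of the list that represents an element.\<close>

lemma sumC_cong_coeffL:
  assumes "\<And>m. linear (\<Theta> m)" "coeffL P = coeffL Q"
  shows "sumC \<Theta> P = sumC \<Theta> Q"
  using assms by (simp add: sumC_eq_sum_coeffL[of \<Theta> "fst ` set P \<union> fst ` set Q"])

lemma sumP_eq_sum_coeffP:
  assumes "\<And>\<mu>. linear (\<Xi> \<mu>)" "finite S" "\<And>F c. (F, c) \<in> set P \<Longrightarrow> Poly_Mapping.keys F \<subseteq> S"
  shows "sumP \<Xi> P = (\<Sum>\<mu>\<in>S. \<Xi> \<mu> (coeffP sm P \<mu>))"
  using assms(3)
proof (induction P)
  case Nil
  then show ?case
    by (simp add: module_hom.zero[OF assms(1)])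
next
  case (Cons x P)
  obtain F c where x: "x = (F, c)"
    by (cases x)
  have "lin F (\<lambda>\<mu>. \<Xi> \<mu> c) = (\<Sum>\<mu>\<in>S. Poly_Mapping.lookup F \<mu> *s \<Xi> \<mu> c)"
    using assms(2) Cons.prems x by (intro lin_superset) auto
  moreover have "sumP \<Xi> P = (\<Sum>\<mu>\<in>S. \<Xi> \<mu> (coeffP sm P \<mu>))"
    using Cons.prems by (intro Cons.IH) auto
  ultimately show ?case
    by (simp add: x coeffP_Cons module_hom.add[OF assms(1)] module_hom.scale[OF assms(1)] sum.distrib)
qed

lemma sumP_cong_coeffP:
  assumes "\<And>\<mu>. linear (\<Xi> \<mu>)" "coeffP sm P = coeffP sm Q"
  shows "sumP \<Xi> P = sumP \<Xi> Q"
proof -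
  let ?S = "\<Union>(F, c)\<in>set P \<union> set Q. Poly_Mapping.keys F"
  have "finite ?S"
    by auto
  then have "sumP \<Xi> P = (\<Sum>\<mu>\<in>?S. \<Xi> \<mu> (coeffP sm P \<mu>))" "sumP \<Xi> Q = (\<Sum>\<mu>\<in>?S. \<Xi> \<mu> (coeffP sm Q \<mu>))"
    by (intro sumP_eq_sum_coeffP assms(1); blast)+
  then show ?thesis
    using assms(2) by simp
qed

lemma sumC_scaleL: "(\<And>m. linear (\<Theta> m)) \<Longrightarrow> sumC \<Theta> (scaleL sm x P) = x *s sumC \<Theta> P"
  by (induction P) (auto simp: scaleL_def module_hom.scale scale_right_distrib)

lemma sumP_scaleL: "(\<And>\<mu>. linear (\<Xi> \<mu>)) \<Longrightarrow> sumP \<Xi> (scaleL sm x P) = x *s sumP \<Xi> P"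
  by (induction P) (auto simp: scaleL_def linear_iff scale_right_distrib lin_scale_right)

lemma linear_evP: "(\<And>m. linear (\<Theta> m)) \<Longrightarrow> linear (evP \<Theta> k B \<mu>)"
  by (simp add: linear_iff evP_def scale_right_distrib mult.commute)

text \<open>Permuting the tensor factors amounts to permuting the exponents k. This matches the
  substitution of \<open>u \<circ> \<sigma>\<close> on the coefficient side.\<close>

lemma sumP_evP_perm_tensor:
  assumes "\<sigma> permutes B"
  shows "sumP (evP \<Theta> k B) (perm_tensor \<sigma> P) = sumP (evP \<Theta> (k \<circ> \<sigma>) B) P"
  by (induction P)
     (auto simp: perm_tensor_def lin_ren evP_def wt_ren_mon[OF assms] expo_ren_mon[OF assms] comp_def)

text \<open>The map $\operatorname{Coeff} C\to C$ which is $c(-1-i)\mapsto D^i c/i!$ on the free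
  $H$-submodule $t^{-1}k[t^{-1}]$ generated by $t^{-1}$, and $0$ on $k[t]$.\<close>

definition phi :: "int \<Rightarrow> 'c \<Rightarrow> 'c"
  where "phi m c = (if m < 0 then (1 / fact (nat (- 1 - m))) *s (D ^^ nat (- 1 - m)) c else 0)"

lemma linear_phi: "linear (phi m)"
  using linear_D_funpow by (auto simp: linear_iff phi_def scale_right_distrib mult.commute)

text \<open>Compatibility with the iterated action t^m D = -m t^(m-1). For m < 0 the Pochhammer
  symbol is the quotient of the two factorials that normalise \<open>phi\<close>.\<close>

lemma phi_funpow_D: "phi m ((D ^^ i) c) = pochhammer (- of_int m) i *s phi (m - int i) c"
proof (cases "m < 0")
  case True
  define p where "p = nat (- 1 - m)"
  have m: "m = - 1 - int p"
    using True by (simp add: p_def)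
  have *: "nat (- 1 - (m - int i)) = p + i"
    by (simp add: m)
  have "fact (p + i) = (fact p * pochhammer (1 + of_nat p) i :: 'k)"
    by (simp add: pochhammer_fact pochhammer_product')
  moreover have "pochhammer (- of_int m) i = (pochhammer (1 + of_nat p) i :: 'k)"
    by (simp add: m add.commute)
  moreover have "fact (p + i) \<noteq> (0 :: 'k)"
    by simp
  ultimately have "1 / fact p = (pochhammer (- of_int m) i / fact (p + i) :: 'k)"
    by (simp add: field_simps)
  moreover have "(D ^^ p) ((D ^^ i) c) = (D ^^ (p + i)) c"
    by (simp add: funpow_add)
  ultimately show ?thesis
    using True by (simp add: phi_def * flip: p_def)
next
  case False
  then obtain q where m: "m = int q"
    by (metis nat_0_le not_less)
  show ?thesis
  proof (cases "q < i")
    \<comment> \<open>Here m \<ge> 0 > m - i: differentiation passes through a constant, so the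
      Pochhammer symbol contains the factor 0 and t^m never reaches the negative powers.\<close>
    case True
    then have "pochhammer (- of_nat q :: 'k) i = 0"
      by (simp add: pochhammer_of_nat_eq_0_lemma)
    then show ?thesis
      by (simp add: m phi_def)
  qed (simp add: m phi_def)
qed

lemma phi_hact:
  "phi m (hact sm D h c)
    = (\<Sum>i\<le>Polynomial.degree h. Polynomial.coeff h i *s (pochhammer (- of_int m) i *s phi (m - int i) c))"
  by (simp add: hact_def module_hom.sum[OF linear_phi] module_hom.scale[OF linear_phi] phi_funpow_D)

text \<open>\<open>phi\<close> descends to Coeff C: the numerical factor in \<open>relC\<close> is
  the Pochhammer symbol that appears when \<open>phi\<close> meets a power of D.\<close>

lemma sumC_phi_relC: "sumC phi (relC sm D r) = 0"
proof -
  obtain m h c where r: "r = (m, h, c)"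
    by (cases r)
  have "(- 1) ^ i * fact i * (of_int m gchoose i) = (pochhammer (- of_int m) i :: 'k)" for i
    by (simp add: gbinomial_pochhammer flip: power_mult_distrib)
  then have "sumC phi (relC sm D r)
      = (\<Sum>i\<leftarrow>[0..<Suc (Polynomial.degree h)].
          Polynomial.coeff h i *s (pochhammer (- of_int m) i *s phi (m - int i) c)) - phi m (hact sm D h c)"
    by (simp add: r relC_def sumC_def comp_def module_hom.scale[OF linear_phi] module_hom.neg[OF linear_phi] mult.assoc
        del: upt_Suc)
  then show ?thesis
    by (simp add: phi_hact interv_sum_list_conv_sum_set_nat atLeast0LessThan lessThan_Suc_atMost del: upt_Suc)
qed

lemma sumC_phi_eq_0:
  assumes "zeroC sm D (coeffL P)"
  shows "sumC phi P = 0"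
proof -
  obtain R where "coeffL P = coeffL (concat (map (relC sm D) R))"
    using assms unfolding zeroC_def by blast
  then have "sumC phi P = sumC phi (concat (map (relC sm D) R))"
    by (rule sumC_cong_coeffL[OF linear_phi])
  also have "\<dots> = 0"
    by (induction R) (simp_all add: sumC_phi_relC)
  finally show ?thesis .
qed

text \<open>D acts on H^{\<otimes>n} as the sum of all variables, which becomes -d/dt on the total
  power of t by the Leibniz rule; \<open>phi\<close> then turns it into D on C.\<close>

lemma sumP_phi_relH: "sumP (evP phi k {..<n}) (relH sm D n r) = 0"
proof -
  obtain G h c where r: "r = (G, h, c)"
    by (cases r)
  let ?X = "\<Sum>j<n. var j :: 'k mpoly"
  have "lin (G * deltaH n h) (\<lambda>\<mu>. evP phi k {..<n} \<mu> c)
      = lin G (\<lambda>\<mu>. \<Sum>i\<le>Polynomial.degree h. Polynomial.coeff h i *s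
          lin (?X ^ i) (\<lambda>\<nu>. wt k {..<n} (\<mu> + \<nu>) *s phi (expo k {..<n} (\<mu> + \<nu>)) c))"
    by (simp add: lin_mult deltaH_def lin_sum evP_def)
  also have "\<dots> = lin G (\<lambda>\<mu>. evP phi k {..<n} \<mu> (hact sm D h c))"
    by (subst lin_power_sum_var) (simp_all add: evP_def phi_hact scale_sum_right mult_ac)
  finally show ?thesis
    by (simp add: r relH_def module_hom.neg[OF linear_evP[OF linear_phi]] lin_def sum_negf)
qed

section \<open>Reduction modulo the relations\<close>

definition eqH :: "nat \<Rightarrow> ('k mpoly \<times> 'c) list \<Rightarrow> ('k mpoly \<times> 'c) list \<Rightarrow> bool"
  where "eqH n P Q \<longleftrightarrow> zeroH sm D n (\<lambda>\<gamma>. coeffP sm P \<gamma> - coeffP sm Q \<gamma>)"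

lemma zeroH_0: "zeroH sm D n (\<lambda>\<gamma>. 0)"
  unfolding zeroH_def by (rule exI[of _ "[]"]) (simp add: fun_eq_iff)

lemma zeroH_add:
  assumes "zeroH sm D n \<Phi>" "zeroH sm D n \<Psi>"
  shows "zeroH sm D n (\<lambda>\<gamma>. \<Phi> \<gamma> + \<Psi> \<gamma>)"
proof -
  obtain R S where "\<forall>(G, h, c) \<in> set R. \<forall>\<mu> \<in> Poly_Mapping.keys G. Poly_Mapping.keys \<mu> \<subseteq> {..<n}"
    "\<Phi> = coeffP sm (concat (map (relH sm D n) R))"
    "\<forall>(G, h, c) \<in> set S. \<forall>\<mu> \<in> Poly_Mapping.keys G. Poly_Mapping.keys \<mu> \<subseteq> {..<n}"
    "\<Psi> = coeffP sm (concat (map (relH sm D n) S))"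
    using assms unfolding zeroH_def by blast
  then show ?thesis
    unfolding zeroH_def by (intro exI[of _ "R @ S"]) (simp add: ball_Un coeffP_append fun_eq_iff)
qed

lemma eqH_coeffP: "coeffP sm P = coeffP sm Q \<Longrightarrow> eqH n P Q"
  by (simp add: eqH_def zeroH_0)

lemma eqH_trans: "eqH n P Q \<Longrightarrow> eqH n Q R \<Longrightarrow> eqH n P R"
  unfolding eqH_def by (drule (1) zeroH_add) simp

lemma eqH_append: "eqH n P Q \<Longrightarrow> eqH n P' Q' \<Longrightarrow> eqH n (P @ P') (Q @ Q')"
  unfolding eqH_def by (drule (1) zeroH_add) (simp add: coeffP_append algebra_simps)

text \<open>The relation for h = D, the single move from which the reduction is built.\<close>

lemma eqH_D:
  assumes "vars_in {..<n} G"
  shows "eqH n [(G * (\<Sum>j<n. var j), c)] [(G, D c)]"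
proof -
  have "deltaH n [:0, 1:] = (\<Sum>j<n. var j :: 'k mpoly)"
    by (simp add: deltaH_def cst_def)
  moreover have "hact sm D [:0, 1:] c = D c"
    by (simp add: hact_def)
  ultimately show ?thesis
    using assms unfolding eqH_def zeroH_def
    by (intro exI[of _ "[(G, [:0, 1:], c)]"]) (simp add: relH_def coeffP_Cons vars_in_def fun_eq_iff)
qed

lemma eqH_sumP:
  assumes "eqH n P Q"
  shows "sumP (evP phi k {..<n}) P = sumP (evP phi k {..<n}) Q"
proof -
  obtain R where R: "(\<lambda>\<gamma>. coeffP sm P \<gamma> - coeffP sm Q \<gamma>) = coeffP sm (concat (map (relH sm D n) R))"
    using assms unfolding eqH_def zeroH_def by blast
  have "coeffP sm P = coeffP sm (Q @ concat (map (relH sm D n) R))"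
    unfolding fun_eq_iff coeffP_append R[symmetric] by simp
  then have "sumP (evP phi k {..<n}) P = sumP (evP phi k {..<n}) (Q @ concat (map (relH sm D n) R))"
    by (rule sumP_cong_coeffP[OF linear_evP[OF linear_phi]])
  moreover have "sumP (evP phi k {..<n}) (concat (map (relH sm D n) R)) = 0" for R
    by (induction R) (simp_all add: sumP_phi_relH)
  ultimately show ?thesis
    by simp
qed

text \<open>The last of the p + 1 variables has index p. That every element is reducible is the
  surjectivity of the natural map from H^{\<otimes>p} \<otimes> C to H^{\<otimes>(p+1)} \<otimes>_H
  C.\<close>

definition reducible :: "nat \<Rightarrow> ('k mpoly \<times> 'c) list \<Rightarrow> bool"
  where "reducible p P \<longleftrightarrow> (\<exists>Q. (\<forall>(F, c)\<in>set Q. vars_in {..<p} F) \<and> eqH (Suc p) P Q)"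

lemma reducible_eqH: "eqH (Suc p) P Q \<Longrightarrow> reducible p Q \<Longrightarrow> reducible p P"
  unfolding reducible_def by (blast intro: eqH_trans)

lemma reducible_append:
  assumes "reducible p P" "reducible p P'"
  shows "reducible p (P @ P')"
proof -
  obtain Q Q' where "\<forall>(F, c)\<in>set Q. vars_in {..<p} F" "eqH (Suc p) P Q"
    "\<forall>(F, c)\<in>set Q'. vars_in {..<p} F" "eqH (Suc p) P' Q'"
    using assms unfolding reducible_def by blast
  then show ?thesis
    unfolding reducible_def by (intro exI[of _ "Q @ Q'"]) (auto intro: eqH_append)
qed

lemma reducible_Nil: "reducible p []"
  unfolding reducible_def by (rule exI[of _ "[]"]) (simp add: eqH_coeffP)

text \<open>Write x_p = (x_0 + ... + x_p) - (x_0 + ... + x_{p-1}). The first bracket is moved across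
  the tensor sign as D, the second involves only earlier variables; either way the power of x_p
  drops by one, while G or c changes.\<close>

lemma reducible_mult_power:
  assumes "vars_in {..<p} G"
  shows "reducible p [(G * var p ^ m, c)]"
  using assms
proof (induction m arbitrary: G c)
  case 0
  then show ?case
    unfolding reducible_def by (intro exI[of _ "[(G, c)]"]) (simp add: eqH_coeffP)
next
  case (Suc m)
  let ?Y = "\<Sum>j<p. var j :: 'k mpoly" and ?X = "\<Sum>j<Suc p. var j :: 'k mpoly"
  have vY: "vars_in {..<p} (- G * ?Y)"
    using Suc.prems by (intro vars_in_mult vars_in_sum vars_in_var) auto
  have vG: "vars_in {..<Suc p} (G * var p ^ m)"
    using Suc.prems by (intro vars_in_mult vars_in_power vars_in_var) (auto elim: vars_in_mono)
  have eq: "G * var p ^ Suc m = G * var p ^ m * ?X + - G * ?Y * var p ^ m"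
    by (simp add: algebra_simps)
  have "coeffP sm [(G * var p ^ Suc m, c)]
      = coeffP sm ([(G * var p ^ m * ?X, c)] @ [(- G * ?Y * var p ^ m, c)])"
    unfolding eq
    by (simp only: fun_eq_iff coeffP_append coeffP_Cons coeffP_Nil lookup_add scale_left_distrib
        add_0_right simp_thms)
  then show ?case
    by (rule reducible_eqH[OF eqH_coeffP])
       (intro reducible_append Suc.IH vY reducible_eqH[OF eqH_D[OF vG]] Suc.prems)
qed

lemma reducible_sum:
  "finite I \<Longrightarrow> (\<And>i. i \<in> I \<Longrightarrow> reducible p [(F i, c)]) \<Longrightarrow> reducible p [(\<Sum>i\<in>I. F i, c)]"
proof (induction I rule: finite_induct)
  case empty
  have "coeffP sm [(\<Sum>i\<in>{}. F i, c)] = coeffP sm []"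
    by (simp add: fun_eq_iff coeffP_Cons)
  then show ?case
    by (rule reducible_eqH[OF eqH_coeffP]) (rule reducible_Nil)
next
  case (insert i I)
  have "coeffP sm [(\<Sum>i\<in>insert i I. F i, c)] = coeffP sm ([(F i, c)] @ [(\<Sum>i\<in>I. F i, c)])"
    using insert.hyps by (simp add: fun_eq_iff coeffP_Cons lookup_add scale_left_distrib)
  then show ?case
    by (rule reducible_eqH[OF eqH_coeffP]) (intro reducible_append insert.IH insert.prems; simp)
qed

lemma var_power: "var p ^ m = (Poly_Mapping.single (Poly_Mapping.single p m) 1 :: 'k mpoly)"
  by (induction m) (simp_all add: var_def mult_single flip: single_add)

lemma reducible_poly:
  assumes "vars_in {..<Suc p} F"
  shows "reducible p [(F, c)]"
proof -
  have "reducible p [(Poly_Mapping.single \<mu> (Poly_Mapping.lookup F \<mu>), c)]"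
    if "\<mu> \<in> Poly_Mapping.keys F" for \<mu>
  proof -
    define \<mu>' where "\<mu>' = Poly_Mapping.update p 0 \<mu>"
    have "\<mu> = \<mu>' + Poly_Mapping.single p (Poly_Mapping.lookup \<mu> p)"
      by (rule poly_mapping_eqI) (simp add: \<mu>'_def lookup_update lookup_add lookup_single when_def)
    then have "Poly_Mapping.single \<mu> (Poly_Mapping.lookup F \<mu>)
        = Poly_Mapping.single \<mu>' (Poly_Mapping.lookup F \<mu>) * var p ^ Poly_Mapping.lookup \<mu> p"
      by (simp add: var_power mult_single)
    moreover have "Poly_Mapping.keys \<mu>' \<subseteq> {..<p}"
      using assms that
      by (fastforce simp: \<mu>'_def vars_in_def keys_update less_Suc_eq)
    ultimately show ?thesis
      using reducible_mult_power vars_in_single by metis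
  qed
  then have "reducible p [(\<Sum>\<mu>\<in>Poly_Mapping.keys F. Poly_Mapping.single \<mu> (Poly_Mapping.lookup F \<mu>), c)]"
    by (intro reducible_sum) auto
  then show ?thesis
    by (simp flip: poly_mapping_eq_sum_single)
qed

lemma reducible_list:
  "(\<And>F c. (F, c) \<in> set P \<Longrightarrow> vars_in {..<Suc p} F) \<Longrightarrow> reducible p P"
proof (induction P)
  case Nil
  then show ?case
    by (simp add: reducible_Nil)
next
  case (Cons x P)
  obtain F c where x: "x = (F, c)"
    by (cases x)
  have "reducible p ([(F, c)] @ P)"
    using Cons by (intro reducible_append reducible_poly) (auto simp: x)
  then show ?case
    by (simp add: x)
qed

text \<open>For $k = (\gamma_0,\dots,\gamma_{p-1},-1)$ only the monomials dividing $x^\gamma$ contribute,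
  and $x^\gamma$ itself is sent to a nonzero multiple of $t^{-1}$.\<close>

lemma coeffP_eq_0:
  assumes vars: "\<And>F c. (F, c) \<in> set Q \<Longrightarrow> vars_in {..<p} F"
    and zero: "\<And>k. sumP (evP phi k {..<Suc p}) Q = 0"
  shows "coeffP sm Q \<gamma> = 0"
proof (induction "\<Sum>j<p. Poly_Mapping.lookup \<gamma> j" arbitrary: \<gamma> rule: less_induct)
  case less
  have outside: "coeffP sm Q \<mu> = 0" if "\<not> Poly_Mapping.keys \<mu> \<subseteq> {..<p}" for \<mu>
  proof -
    have "Poly_Mapping.lookup F \<mu> = 0" if "(F, c) \<in> set Q" for F c
      using vars[OF that] \<open>\<not> Poly_Mapping.keys \<mu> \<subseteq> {..<p}\<close> by (auto simp: vars_in_def in_keys_iff)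
    then have "map (\<lambda>(F, c). Poly_Mapping.lookup F \<mu> *s c) Q = map (\<lambda>_. 0) Q"
      by (intro map_cong refl) auto
    then show ?thesis
      unfolding coeffP_def by (simp only: sum_list_0)
  qed
  show ?case
  proof (cases "Poly_Mapping.keys \<gamma> \<subseteq> {..<p}")
    case False
    then show ?thesis
      by (rule outside)
  next
    case True
    define k where "k j = (if j < p then int (Poly_Mapping.lookup \<gamma> j) else - 1)" for j
    \<comment> \<open>\<gamma> is inserted so that its summand can be split off even if it occurs in
      no F.\<close>
    define S where "S = insert \<gamma> (\<Union>(F, c)\<in>set Q. Poly_Mapping.keys F)"
    let ?e = "evP phi k {..<Suc p}"
    have fin: "finite S"
      by (auto simp: S_def)
    \<comment> \<open>If \<mu>_j > \<gamma>_j for some j < p, then t_j^{\<gamma>_j} is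
      differentiated to 0. Otherwise \<mu> is a proper divisor, of smaller degree, and its
      coefficient vanishes by induction.\<close>
    have "?e \<mu> (coeffP sm Q \<mu>) = 0" if "\<mu> \<noteq> \<gamma>" for \<mu>
    proof (rule ccontr)
      assume nz: "?e \<mu> (coeffP sm Q \<mu>) \<noteq> 0"
      then have c: "coeffP sm Q \<mu> \<noteq> 0"
        using module_hom.zero[OF linear_evP[OF linear_phi]] by auto
      then have keys: "Poly_Mapping.keys \<mu> \<subseteq> {..<p}"
        using outside by blast
      have wt: "wt k {..<Suc p} \<mu> \<noteq> (0 :: 'k)"
        using nz by (auto simp: evP_def)
      have le: "Poly_Mapping.lookup \<mu> j \<le> Poly_Mapping.lookup \<gamma> j" if "j < p" for j
      proof -
        have "pochhammer (- of_int (k j) :: 'k) (Poly_Mapping.lookup \<mu> j) \<noteq> 0"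
          using wt that by (simp add: wt_def)
        then show ?thesis
          using that by (simp add: k_def pochhammer_of_nat_eq_0_iff not_less)
      qed
      obtain j where j: "Poly_Mapping.lookup \<mu> j \<noteq> Poly_Mapping.lookup \<gamma> j"
        using \<open>\<mu> \<noteq> \<gamma>\<close> poly_mapping_eqI by metis
      then have "j < p"
        using lookup_outside[OF keys, of j] lookup_outside[OF True, of j] by (cases "j < p") auto
      with j le[OF this] have "Poly_Mapping.lookup \<mu> j < Poly_Mapping.lookup \<gamma> j"
        by simp
      then have "(\<Sum>j<p. Poly_Mapping.lookup \<mu> j) < (\<Sum>j<p. Poly_Mapping.lookup \<gamma> j)"
        using le \<open>j < p\<close> by (intro sum_strict_mono_ex1) auto
      then show False
        using less c by blast
    qed
    then have "(\<Sum>\<mu>\<in>S. ?e \<mu> (coeffP sm Q \<mu>)) = ?e \<gamma> (coeffP sm Q \<gamma>)"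
      using fin by (subst sum.remove[of S \<gamma>]) (auto simp: S_def intro!: sum.neutral)
    moreover have "(\<Sum>\<mu>\<in>S. ?e \<mu> (coeffP sm Q \<mu>)) = sumP ?e Q"
      by (rule sumP_eq_sum_coeffP[symmetric]) (use fin in \<open>auto simp: S_def linear_evP linear_phi\<close>)
    ultimately have "?e \<gamma> (coeffP sm Q \<gamma>) = 0"
      using zero by simp
    \<comment> \<open>The first p powers are differentiated down to constants and x_p does not occur
      in \<gamma>, so t^{-1} remains; \<open>phi (- 1)\<close> is the identity.\<close>
    moreover have "expo k {..<Suc p} \<gamma> = - 1"
      using lookup_outside[OF True, of p] by (simp add: expo_def k_def)
    ultimately have *: "(wt k {..<Suc p} \<gamma> :: 'k) *s coeffP sm Q \<gamma> = 0"
      by (simp add: evP_def phi_def)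
    \<comment> \<open>Each j < p contributes \<gamma>_j! up to sign, and the last variable
      contributes 1.\<close>
    have "wt k {..<Suc p} \<gamma> \<noteq> (0 :: 'k)"
      using lookup_outside[OF True, of p] by (auto simp: wt_def k_def pochhammer_of_nat_eq_0_iff)
    then show ?thesis
      using arg_cong[OF *, of "\<lambda>x. inverse (wt k {..<Suc p} \<gamma>) *s x"] by simp
  qed
qed

text \<open>The maps \<open>evP phi k\<close> separate the points of H^{\<otimes>(p+1)} \<otimes>_H
  C. They take the same values on P and on its reduced form Q, whose coefficients must then vanish,
  so P itself is a sum of relations.\<close>

lemma zeroH_if_sumP_eq_0:
  assumes "\<And>F c. (F, c) \<in> set P \<Longrightarrow> vars_in {..<Suc p} F"
    and "\<And>k. sumP (evP phi k {..<Suc p}) P = 0"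
  shows "zeroH sm D (Suc p) (coeffP sm P)"
proof -
  have "reducible p P"
    by (intro reducible_list) (rule assms(1))
  then obtain Q where Q: "\<forall>(F, c)\<in>set Q. vars_in {..<p} F" "eqH (Suc p) P Q"
    unfolding reducible_def by blast
  have "coeffP sm Q \<gamma> = 0" for \<gamma>
    using Q(1) eqH_sumP[OF Q(2)] assms(2) by (intro coeffP_eq_0) auto
  then show ?thesis
    using Q(2) by (simp add: eqH_def)
qed

text \<open>The identity of Coeff C is used only at the single terms u_j = a_j(k_j), for all integer
  vectors k; applying \<open>phi\<close> to it gives the value of \<open>evP phi k\<close> on
  f^*.\<close>

lemma pseudo_identity:
  assumes hom: "\<And>\<sigma> c t. \<sigma> permutes {..<n} \<Longrightarrow> (c, t) \<in> set (f \<sigma>) \<Longrightarrow> nleaves t = n"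
    and coeff_id: "\<And>u :: nat \<Rightarrow> (int \<times> 'c) list. zeroC sm D
        (\<lambda>k. \<Sum>\<sigma>\<in>{\<sigma>. \<sigma> permutes {..<n}}.
           sum_list (map (\<lambda>(c, t). coeffL (scaleL sm c (evalT (prodC sm pr) t (u \<circ> \<sigma>) 0)) k) (f \<sigma>)))"
  shows "zeroH sm D n
        (\<lambda>\<gamma>. \<Sum>\<sigma>\<in>{\<sigma>. \<sigma> permutes {..<n}}.
           sum_list (map (\<lambda>(c, t). coeffP sm (scaleL sm c
              (perm_tensor \<sigma> (starT pr t (a \<circ> \<sigma>) 0))) \<gamma>) (f \<sigma>)))"
proof -
  have "finite {\<sigma>. \<sigma> permutes {..<n}}"
    by (simp add: finite_permutations)
  then obtain \<sigma>s where \<sigma>s: "set \<sigma>s = {\<sigma>. \<sigma> permutes {..<n}}" "distinct \<sigma>s"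
    using finite_distinct_list by blast
  define A :: "(nat \<Rightarrow> nat) \<Rightarrow> 'k \<times> btree \<Rightarrow> ('k mpoly \<times> 'c) list"
    where "A \<sigma> x = scaleL sm (fst x) (perm_tensor \<sigma> (starT pr (snd x) (a \<circ> \<sigma>) 0))" for \<sigma> x
  define B where "B k \<sigma> x =
    scaleL sm (fst x) (evalT (prodC sm pr) (snd x) ((\<lambda>j. [(k j, a j)]) \<circ> \<sigma>) 0)" for k \<sigma> x
  define P where "P = concat (map (\<lambda>\<sigma>. concat (map (A \<sigma>) (f \<sigma>))) \<sigma>s)"
  define U where "U k = concat (map (\<lambda>\<sigma>. concat (map (B k \<sigma>) (f \<sigma>))) \<sigma>s)" for k
  have P: "coeffP sm P = (\<lambda>\<gamma>. \<Sum>\<sigma>\<in>{\<sigma>. \<sigma> permutes {..<n}}.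
      sum_list (map (\<lambda>(c, t). coeffP sm (scaleL sm c (perm_tensor \<sigma> (starT pr t (a \<circ> \<sigma>) 0))) \<gamma>) (f \<sigma>)))"
    by (simp add: fun_eq_iff P_def coeffP_concat comp_def A_def case_prod_unfold
        sum_list_distinct_conv_sum_set[OF \<sigma>s(2)] \<sigma>s(1))
  have U: "coeffL (U k) = (\<lambda>l. \<Sum>\<sigma>\<in>{\<sigma>. \<sigma> permutes {..<n}}. sum_list (map (\<lambda>(c, t).
      coeffL (scaleL sm c (evalT (prodC sm pr) t ((\<lambda>j. [(k j, a j)]) \<circ> \<sigma>) 0)) l) (f \<sigma>)))" for k
    by (simp add: fun_eq_iff U_def coeffL_concat comp_def B_def case_prod_unfold
        sum_list_distinct_conv_sum_set[OF \<sigma>s(2)] \<sigma>s(1))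
  have ev: "sumP (evP phi k {..<n}) (A \<sigma> x) = sumC phi (B k \<sigma> x)"
    if \<sigma>: "\<sigma> permutes {..<n}" "x \<in> set (f \<sigma>)" for k \<sigma> x
  proof -
    have *: "nleaves (snd x) = n"
      using hom[OF \<sigma>(1), of "fst x" "snd x"] \<sigma>(2) by simp
    have "(\<lambda>j. [(k j, a j)]) \<circ> \<sigma> = (\<lambda>j. [((k \<circ> \<sigma>) j, (a \<circ> \<sigma>) j)])"
      by (simp add: fun_eq_iff)
    then show ?thesis
      using sumC_evalT[of phi "snd x" "k \<circ> \<sigma>" "a \<circ> \<sigma>" 0, OF linear_phi]
      unfolding A_def B_def sumP_scaleL[OF linear_evP[OF linear_phi]] sumC_scaleL[OF linear_phi]
        sumP_evP_perm_tensor[OF \<sigma>(1)] * by (simp add: atLeast0LessThan)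
  qed
  have "sumP (evP phi k {..<n}) P = sumC phi (U k)" for k
  proof -
    have "(\<Sum>\<sigma>\<leftarrow>\<sigma>s. \<Sum>x\<leftarrow>f \<sigma>. sumP (evP phi k {..<n}) (A \<sigma> x))
        = (\<Sum>\<sigma>\<leftarrow>\<sigma>s. \<Sum>x\<leftarrow>f \<sigma>. sumC phi (B k \<sigma> x))"
      using \<sigma>s(1) by (intro arg_cong[where f = sum_list] map_cong refl ev) auto
    then show ?thesis
      by (simp add: P_def U_def sumP_concat sumC_concat comp_def)
  qed
  moreover have "sumC phi (U k) = 0" for k
    by (rule sumC_phi_eq_0) (use coeff_id in \<open>simp add: U\<close>)
  ultimately have zero: "sumP (evP phi k {..<n}) P = 0" for k
    by simp
  have vars: "vars_in {..<n} F" if FP: "(F, c) \<in> set P" for F c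
  proof -
    obtain \<sigma> x where \<sigma>: "\<sigma> permutes {..<n}" "x \<in> set (f \<sigma>)" and "(F, c) \<in> set (A \<sigma> x)"
      using FP \<sigma>s(1) unfolding P_def by auto
    then obtain G d where G: "(G, d) \<in> set (starT pr (snd x) (a \<circ> \<sigma>) 0)" and F: "F = ren \<sigma> G"
      by (auto simp: A_def scaleL_def perm_tensor_def)
    have "nleaves (snd x) = n"
      using hom[OF \<sigma>(1), of "fst x" "snd x"] \<sigma>(2) by simp
    then have "vars_in {..<n} G"
      using vars_in_starT[OF G] by (simp add: atLeast0LessThan)
    then show ?thesis
      unfolding F by (rule vars_in_ren[OF \<sigma>(1)])
  qed
  have "zeroH sm D n (coeffP sm P)"
  proof (cases n)
    \<comment> \<open>There is no last variable to eliminate here. Every bracketing has a leaf, so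
      homogeneity of degree 0 leaves only the empty polynomial.\<close>
    case 0
    have "nleaves t > 0" for t
      by (induction t) auto
    then have "f \<sigma> = []" if "\<sigma> permutes {..<n}" for \<sigma>
      using hom[OF that] 0 by (metis less_irrefl list.set_intros(1) neq_Nil_conv surj_pair)
    then have "P = []"
      by (auto simp: P_def \<sigma>s(1))
    moreover have "coeffP sm [] = (\<lambda>\<gamma>. 0)"
      by (simp add: fun_eq_iff)
    ultimately show ?thesis
      by (simp add: zeroH_0)
  next
    case (Suc p)
    then show ?thesis
      using zeroH_if_sumP_eq_0[of P p] vars zero by simp
  qed
  then show ?thesis
    unfolding P .
qed

end

theorem theorem3p1:
  fixes sm :: "'k::field_char_0 \<Rightarrow> 'c::ab_group_add \<Rightarrow> 'c"
    and D :: "'c \<Rightarrow> 'c"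
    and pr :: "nat \<Rightarrow> 'c \<Rightarrow> 'c \<Rightarrow> 'c"
    and n :: nat
    and f :: "(nat \<Rightarrow> nat) \<Rightarrow> ('k \<times> btree) list"
  assumes conf: "conformal_algebra sm D pr"
    and hom: "\<And>\<sigma> c t. \<sigma> permutes {..<n} \<Longrightarrow> (c, t) \<in> set (f \<sigma>) \<Longrightarrow> nleaves t = n"
    and coeff_id: "\<And>u :: nat \<Rightarrow> (int \<times> 'c) list. zeroC sm D
        (\<lambda>k. \<Sum>\<sigma>\<in>{\<sigma>. \<sigma> permutes {..<n}}.
           sum_list (map (\<lambda>(c, t). coeffL (scaleL sm c (evalT (prodC sm pr) t (u \<circ> \<sigma>) 0)) k) (f \<sigma>)))"
  shows "\<forall>a :: nat \<Rightarrow> 'c. zeroH sm D n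
        (\<lambda>\<gamma>. \<Sum>\<sigma>\<in>{\<sigma>. \<sigma> permutes {..<n}}.
           sum_list (map (\<lambda>(c, t). coeffP sm (scaleL sm c
              (perm_tensor \<sigma> (starT pr t (a \<circ> \<sigma>) 0 :: ('k mpoly \<times> 'c) list))) \<gamma>) (f \<sigma>)))"
proof -
  have "module sm"
    using conf by (simp add: conformal_algebra_def)
  then interpret conformal sm D pr
    using conf by (simp add: conformal_def mpoly_lin_def conformal_axioms_def)
  show ?thesis
    by (rule allI, rule pseudo_identity) (erule (1) hom, rule coeff_id)
qed

end
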